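(* Suppose $(X,\tau)$ is an extended locally convex space with finest locally convex topology $\tau_F$. If $U$ is an absolutely convex neighborhood of $0$ in $(X,\tau)$, then the following statements are equivalent: (1) $U^\circ$ is weak$^*$ compact; (2) $0\in\mathrm{Core}(U)$; (3) $U$ is a neighborhood of $0$ in $(X,\tau_F)$.
   Context: Vector spaces are over $\mathbb{K}$, where $\mathbb{K}$ is $\mathbb{R}$ or $\mathbb{C}$. An extended seminorm on $X$ is a map $\rho:X\to[0,\infty]$ with $\rho(\alpha x)=|\alpha|\rho(x)$ (convention $0\cdot\infty=0$) and $\rho(x+y)\le\rho(x)+\rho(y)$. An extended locally convex space (elcs) is a vector space $X$ with a group topology $\tau$ induced by a family $\{\rho_i\}_{i\in I}$ of extended seminorms, i.e. the sets $\{y:\rho_i(y-x)<\varepsilon \text{ for all } i\in J\}$ with $\varepsilon>0$ and $J\subseteq I$ finite form a neighborhood base at $x$. $X^*$ is the set of all $\tau$-continuous linear functionals $X\to\mathbb{K}$. The finest locally convex topology (flc topology) $\tau_F$ of $(X,\tau)$ is the finest locally convex topology on $X$ (i.e. one induced by finite-valued seminorms) that is coarser than $\tau$. The weak$^*$ topology on $X^*$ is induced by the seminorms $f\mapsto|f(x)|$, $x\in X$. Absolutely convex means balanced and convex. $U^\circ=\{f\in X^*:|f(x)|\le1\text{ for all }x\in U\}$. $0\in\mathrm{Core}(U)$ means that for every $x\in X$ there is $\delta_x>0$ with $tx\in U$ for all $0\le t\le\delta_x$. *)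

theory Defs
  imports "HOL-Analysis.Analysis"
begin

text \<open>Scalar fields: normed fields that are the reals or the complex numbers, up to isometric
  isomorphism.\<close>

class real_or_complex = real_normed_field +
  assumes real_or_complex:
    "(\<exists>\<phi>::'a \<Rightarrow> real. bij \<phi> \<and> (\<forall>x y. \<phi> (x + y) = \<phi> x + \<phi> y) \<and>
        (\<forall>x y. \<phi> (x * y) = \<phi> x * \<phi> y) \<and> (\<forall>x. norm (\<phi> x) = norm x)) \<or>
     (\<exists>\<phi>::'a \<Rightarrow> complex. bij \<phi> \<and> (\<forall>x y. \<phi> (x + y) = \<phi> x + \<phi> y) \<and>
        (\<forall>x y. \<phi> (x * y) = \<phi> x * \<phi> y) \<and> (\<forall>x. norm (\<phi> x) = norm x))"

instance real :: real_or_complex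
  by standard (rule disjI1, rule exI[of _ id], simp)

instance complex :: real_or_complex
  by standard (rule disjI2, rule exI[of _ id], simp)

text \<open>The carrier of a vector space is a whole type; its scalar multiplication \<open>s\<close> is a
  parameter.\<close>

definition extended_seminorm ::
    "('k::real_normed_field \<Rightarrow> 'x::ab_group_add \<Rightarrow> 'x) \<Rightarrow> ('x \<Rightarrow> ennreal) \<Rightarrow> bool" where
  "extended_seminorm s \<rho> \<longleftrightarrow>
     (\<forall>a x. \<rho> (s a x) = ennreal (norm a) * \<rho> x) \<and> (\<forall>x y. \<rho> (x + y) \<le> \<rho> x + \<rho> y)"

text \<open>A family of seminorms is represented by the set of its members, since the topology does not
  depend on the indexing.\<close>

definition seminorm_topology :: "('x::ab_group_add \<Rightarrow> ennreal) set \<Rightarrow> 'x topology" where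
  "seminorm_topology P = topology (\<lambda>W. \<forall>x\<in>W. \<exists>J e. J \<subseteq> P \<and> finite J \<and> 0 < (e::real) \<and>
     {y. \<forall>\<rho>\<in>J. \<rho> (y - x) < ennreal e} \<subseteq> W)"

definition nbhd_in :: "'a topology \<Rightarrow> 'a \<Rightarrow> 'a set \<Rightarrow> bool" where
  "nbhd_in T x N \<longleftrightarrow> (\<exists>W. openin T W \<and> x \<in> W \<and> W \<subseteq> N)"

text \<open>\<open>seminorm_topology P\<close> is always a group topology, see
  \<open>continuous_map_add_seminorm_topology\<close> and \<open>continuous_map_uminus_seminorm_topology\<close> below.\<close>

definition elcs :: "('k::real_normed_field \<Rightarrow> 'x::ab_group_add \<Rightarrow> 'x) \<Rightarrow> 'x topology \<Rightarrow> bool" where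
  "elcs s \<tau> \<longleftrightarrow> vector_space s \<and>
     (\<exists>P. (\<forall>\<rho>\<in>P. extended_seminorm s \<rho>) \<and> \<tau> = seminorm_topology P)"

definition locally_convex_topology ::
    "('k::real_normed_field \<Rightarrow> 'x::ab_group_add \<Rightarrow> 'x) \<Rightarrow> 'x topology \<Rightarrow> bool" where
  "locally_convex_topology s \<sigma> \<longleftrightarrow>
     (\<exists>P. (\<forall>\<rho>\<in>P. extended_seminorm s \<rho> \<and> (\<forall>x. \<rho> x < \<infinity>)) \<and> \<sigma> = seminorm_topology P)"

definition coarser :: "'a topology \<Rightarrow> 'a topology \<Rightarrow> bool" where
  "coarser S T \<longleftrightarrow> (\<forall>W. openin S W \<longrightarrow> openin T W)"

text \<open>Existence and uniqueness: \<open>flc_topology_exists\<close> and \<open>flc_topology_unique\<close> below.\<close>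

definition flc_topology ::
    "('k::real_normed_field \<Rightarrow> 'x::ab_group_add \<Rightarrow> 'x) \<Rightarrow> 'x topology \<Rightarrow> 'x topology \<Rightarrow> bool" where
  "flc_topology s \<tau> \<tau>F \<longleftrightarrow> locally_convex_topology s \<tau>F \<and> coarser \<tau>F \<tau> \<and>
     (\<forall>\<sigma>. locally_convex_topology s \<sigma> \<and> coarser \<sigma> \<tau> \<longrightarrow> coarser \<sigma> \<tau>F)"

definition dual ::
    "('k::real_normed_field \<Rightarrow> 'x::ab_group_add \<Rightarrow> 'x) \<Rightarrow> 'x topology \<Rightarrow> ('x \<Rightarrow> 'k) set" where
  "dual s \<tau> = {f. Vector_Spaces.linear s (*) f \<and> continuous_map \<tau> euclidean f}"

definition weak_star ::
    "('k::real_normed_field \<Rightarrow> 'x::ab_group_add \<Rightarrow> 'x) \<Rightarrow> 'x topology \<Rightarrow> ('x \<Rightarrow> 'k) topology" where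
  "weak_star s \<tau> = topology (\<lambda>W. W \<subseteq> dual s \<tau> \<and>
     (\<forall>f\<in>W. \<exists>F e. finite F \<and> 0 < (e::real) \<and>
        {g \<in> dual s \<tau>. \<forall>x\<in>F. norm (g x - f x) < e} \<subseteq> W))"

definition polar ::
    "('k::real_normed_field \<Rightarrow> 'x::ab_group_add \<Rightarrow> 'x) \<Rightarrow> 'x topology \<Rightarrow> 'x set \<Rightarrow> ('x \<Rightarrow> 'k) set" where
  "polar s \<tau> U = {f \<in> dual s \<tau>. \<forall>x\<in>U. norm (f x) \<le> 1}"

definition absolutely_convex ::
    "('k::real_normed_field \<Rightarrow> 'x::ab_group_add \<Rightarrow> 'x) \<Rightarrow> 'x set \<Rightarrow> bool" where
  "absolutely_convex s U \<longleftrightarrow>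
     (\<forall>a. \<forall>x\<in>U. norm a \<le> 1 \<longrightarrow> s a x \<in> U) \<and>
     (\<forall>x\<in>U. \<forall>y\<in>U. \<forall>t::real. 0 \<le> t \<and> t \<le> 1 \<longrightarrow> s (of_real (1 - t)) x + s (of_real t) y \<in> U)"

definition zero_in_core ::
    "('k::real_normed_field \<Rightarrow> 'x::ab_group_add \<Rightarrow> 'x) \<Rightarrow> 'x set \<Rightarrow> bool" where
  "zero_in_core s U \<longleftrightarrow> (\<forall>x. \<exists>d::real. 0 < d \<and> (\<forall>t. 0 \<le> t \<and> t \<le> d \<longrightarrow> s (of_real t) x \<in> U))"


lemma openin_seminorm_topology:
  "openin (seminorm_topology P) W \<longleftrightarrow> (\<forall>x\<in>W. \<exists>J e. J \<subseteq> P \<and> finite J \<and> 0 < (e::real) \<and>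
     {y. \<forall>\<rho>\<in>J. \<rho> (y - x) < ennreal e} \<subseteq> W)"
proof -
  let ?L = "\<lambda>W. \<forall>x\<in>W. \<exists>J e. J \<subseteq> P \<and> finite J \<and> 0 < (e::real) \<and>
     {y. \<forall>\<rho>\<in>J. \<rho> (y - x) < ennreal e} \<subseteq> W"
  have "istopology ?L"
    unfolding istopology_def
  proof (intro conjI allI impI ballI)
    fix S T x assume S: "?L S" and T: "?L T" and x: "x \<in> S \<inter> T"
    obtain J e where J: "J \<subseteq> P" "finite J" "0 < e" "{y. \<forall>\<rho>\<in>J. \<rho> (y - x) < ennreal e} \<subseteq> S"
      using bspec[OF S IntD1[OF x]] by (elim exE conjE)
    obtain K d where K: "K \<subseteq> P" "finite K" "0 < d" "{y. \<forall>\<rho>\<in>K. \<rho> (y - x) < ennreal d} \<subseteq> T"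
      using bspec[OF T IntD2[OF x]] by (elim exE conjE)
    have "ennreal (min e d) \<le> ennreal e" "ennreal (min e d) \<le> ennreal d"
      by (auto intro: ennreal_leI)
    then have "{y. \<forall>\<rho>\<in>J \<union> K. \<rho> (y - x) < ennreal (min e d)} \<subseteq>
        {y. \<forall>\<rho>\<in>J. \<rho> (y - x) < ennreal e} \<inter> {y. \<forall>\<rho>\<in>K. \<rho> (y - x) < ennreal d}"
      by (auto intro: less_le_trans)
    then have "{y. \<forall>\<rho>\<in>J \<union> K. \<rho> (y - x) < ennreal (min e d)} \<subseteq> S \<inter> T"
      using Int_mono[OF J(4) K(4)] by (rule order_trans)
    then show "\<exists>J e. J \<subseteq> P \<and> finite J \<and> 0 < (e::real) \<and> {y. \<forall>\<rho>\<in>J. \<rho> (y - x) < ennreal e} \<subseteq> S \<inter> T"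
      using J(1-3) K(1-3) by (intro exI[of _ "J \<union> K"] exI[of _ "min e d"] conjI) simp_all
  next
    fix \<K> x assume K: "\<forall>S\<in>\<K>. ?L S" and "x \<in> \<Union> \<K>"
    then obtain S where S: "S \<in> \<K>" "x \<in> S" by (elim UnionE)
    have "?L S" using K S(1) by (rule bspec)
    from bspec[OF this S(2)] obtain J e where J: "J \<subseteq> P" "finite J" "0 < (e::real)"
      "{y. \<forall>\<rho>\<in>J. \<rho> (y - x) < ennreal e} \<subseteq> S"
      by (elim exE conjE)
    have "{y. \<forall>\<rho>\<in>J. \<rho> (y - x) < ennreal e} \<subseteq> \<Union> \<K>"
      using J(4) Union_upper[OF S(1)] by (rule order_trans)
    then show "\<exists>J e. J \<subseteq> P \<and> finite J \<and> 0 < (e::real) \<and> {y. \<forall>\<rho>\<in>J. \<rho> (y - x) < ennreal e} \<subseteq> \<Union> \<K>"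
      using J(1-3) by (intro exI conjI)
  qed
  then show ?thesis
    unfolding seminorm_topology_def by (simp add: topology_inverse')
qed

lemma openin_seminorm_topologyE:
  assumes "openin (seminorm_topology P) W" "x \<in> W"
  obtains J e where "J \<subseteq> P" "finite J" "0 < (e::real)" "{y. \<forall>\<rho>\<in>J. \<rho> (y - x) < ennreal e} \<subseteq> W"
proof -
  have "\<exists>J e. J \<subseteq> P \<and> finite J \<and> 0 < (e::real) \<and> {y. \<forall>\<rho>\<in>J. \<rho> (y - x) < ennreal e} \<subseteq> W"
    using assms(1)[unfolded openin_seminorm_topology] assms(2) by (rule bspec)
  then show thesis
    by (elim exE conjE) (rule that)
qed

lemma topspace_seminorm_topology [simp]: "topspace (seminorm_topology P) = UNIV"
proof -
  have "openin (seminorm_topology P) UNIV"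
    unfolding openin_seminorm_topology
    by (intro ballI exI[of _ "{}"] exI[of _ 1]) auto
  then show ?thesis
    using openin_subset by blast
qed

lemma openin_weak_star:
  "openin (weak_star s \<tau>) W \<longleftrightarrow> W \<subseteq> dual s \<tau> \<and>
     (\<forall>f\<in>W. \<exists>F e. finite F \<and> 0 < (e::real) \<and>
        {g \<in> dual s \<tau>. \<forall>x\<in>F. norm (g x - f x) < e} \<subseteq> W)"
proof -
  let ?Q = "\<lambda>W f. \<exists>F e. finite F \<and> 0 < (e::real) \<and>
        {g \<in> dual s \<tau>. \<forall>x\<in>F. norm (g x - f x) < e} \<subseteq> W"
  let ?L = "\<lambda>W. W \<subseteq> dual s \<tau> \<and> (\<forall>f\<in>W. ?Q W f)"
  have int: "?Q (S \<inter> T) f" if "?Q S f" "?Q T f" for S T f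
  proof -
    obtain F e where F: "finite F" "0 < e" "{g \<in> dual s \<tau>. \<forall>x\<in>F. norm (g x - f x) < e} \<subseteq> S"
      using \<open>?Q S f\<close> by (elim exE conjE)
    obtain G d where G: "finite G" "0 < d" "{g \<in> dual s \<tau>. \<forall>x\<in>G. norm (g x - f x) < d} \<subseteq> T"
      using \<open>?Q T f\<close> by (elim exE conjE)
    have "{g \<in> dual s \<tau>. \<forall>x\<in>F \<union> G. norm (g x - f x) < min e d} \<subseteq>
        {g \<in> dual s \<tau>. \<forall>x\<in>F. norm (g x - f x) < e} \<inter> {g \<in> dual s \<tau>. \<forall>x\<in>G. norm (g x - f x) < d}"
      by auto
    then have "{g \<in> dual s \<tau>. \<forall>x\<in>F \<union> G. norm (g x - f x) < min e d} \<subseteq> S \<inter> T"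
      using Int_mono[OF F(3) G(3)] by (rule order_trans)
    then show ?thesis
      using F(1,2) G(1,2) by (intro exI[of _ "F \<union> G"] exI[of _ "min e d"] conjI) simp_all
  qed
  have "istopology ?L"
    unfolding istopology_def
  proof (rule conjI; intro allI impI; rule conjI; (intro ballI)?)
    fix S T f assume *: "?L S" "?L T" and "f \<in> S \<inter> T"
    then have "?Q S f" "?Q T f" by simp_all
    then show "?Q (S \<inter> T) f" by (rule int)
  next
    fix S T assume "?L S" "?L T"
    then show "S \<inter> T \<subseteq> dual s \<tau>" by (meson Int_lower1 order_trans)
  next
    fix \<K> assume "\<forall>S\<in>\<K>. ?L S"
    then show "\<Union> \<K> \<subseteq> dual s \<tau>" by (simp add: Sup_le_iff)
  next
    fix \<K> f assume *: "\<forall>S\<in>\<K>. ?L S" and "f \<in> \<Union> \<K>"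
    then obtain S where S: "S \<in> \<K>" "f \<in> S" by (elim UnionE)
    then have "?Q S f" using * by simp
    then obtain F e where F: "finite F" "0 < e" "{g \<in> dual s \<tau>. \<forall>x\<in>F. norm (g x - f x) < e} \<subseteq> S"
      by (elim exE conjE)
    have "{g \<in> dual s \<tau>. \<forall>x\<in>F. norm (g x - f x) < e} \<subseteq> \<Union> \<K>"
      using F(3) Union_upper[OF S(1)] by (rule order_trans)
    then show "?Q (\<Union> \<K>) f" using F(1,2) by (intro exI conjI)
  qed
  then show ?thesis
    unfolding weak_star_def by (simp add: topology_inverse')
qed

lemma topspace_weak_star [simp]: "topspace (weak_star s \<tau>) = dual s \<tau>"
proof -
  have "openin (weak_star s \<tau>) (dual s \<tau>)"
    unfolding openin_weak_star
    by (intro conjI ballI exI[of _ "{}"] exI[of _ 1]) auto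
  then show ?thesis
    using openin_subset openin_topspace[of "weak_star s \<tau>"]
    unfolding openin_weak_star[of s \<tau> "topspace (weak_star s \<tau>)"] by (intro subset_antisym) simp_all
qed

lemma
  assumes "vector_space s" "extended_seminorm s \<rho>"
  shows extended_seminorm_zero: "\<rho> 0 = 0"
    and extended_seminorm_uminus: "\<rho> (- x) = \<rho> x"
proof -
  interpret vector_space s by fact
  have eq: "\<rho> (s a x) = ennreal (norm a) * \<rho> x" for a x
    using assms(2) by (simp add: extended_seminorm_def)
  show "\<rho> 0 = 0"
    using eq[of 0 0] by simp
  show "\<rho> (- x) = \<rho> x"
    using eq[of "- 1" x] by simp
qed

lemma extended_seminorm_triangle:
  assumes "extended_seminorm s \<rho>"
  shows "\<rho> (x + y) \<le> \<rho> x + \<rho> y"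
  using assms by (simp add: extended_seminorm_def)

lemma nbhd_in_seminorm_topology:
  assumes "vector_space s" "\<forall>\<rho>\<in>P. extended_seminorm s \<rho>"
  shows "nbhd_in (seminorm_topology P) x N \<longleftrightarrow>
     (\<exists>J e. J \<subseteq> P \<and> finite J \<and> 0 < (e::real) \<and> {y. \<forall>\<rho>\<in>J. \<rho> (y - x) < ennreal e} \<subseteq> N)"
proof
  assume "nbhd_in (seminorm_topology P) x N"
  then obtain W where W: "openin (seminorm_topology P) W" "x \<in> W" "W \<subseteq> N"
    unfolding nbhd_in_def by (elim exE conjE)
  from W(1,2) obtain J e where J: "J \<subseteq> P" "finite J" "0 < (e::real)"
    "{y. \<forall>\<rho>\<in>J. \<rho> (y - x) < ennreal e} \<subseteq> W"
    by (rule openin_seminorm_topologyE)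
  have "{y. \<forall>\<rho>\<in>J. \<rho> (y - x) < ennreal e} \<subseteq> N"
    using J(4) W(3) by (rule order_trans)
  then show "\<exists>J e. J \<subseteq> P \<and> finite J \<and> 0 < (e::real) \<and> {y. \<forall>\<rho>\<in>J. \<rho> (y - x) < ennreal e} \<subseteq> N"
    using J(1-3) by (intro exI conjI)
next
  assume "\<exists>J e. J \<subseteq> P \<and> finite J \<and> 0 < (e::real) \<and> {y. \<forall>\<rho>\<in>J. \<rho> (y - x) < ennreal e} \<subseteq> N"
  then obtain J e where J: "J \<subseteq> P" "finite J" "0 < (e::real)"
    and N: "{y. \<forall>\<rho>\<in>J. \<rho> (y - x) < ennreal e} \<subseteq> N" by (elim exE conjE)
  let ?W = "{y. \<forall>\<rho>\<in>J. \<rho> (y - x) < ennreal e}"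
  have "openin (seminorm_topology P) ?W"
    unfolding openin_seminorm_topology
  proof
    fix z assume z: "z \<in> ?W"
    have "\<exists>d>0. \<forall>\<rho>\<in>J. \<rho> (z - x) + ennreal d \<le> ennreal e"
      using \<open>finite J\<close> z
    proof (induction J)
      case empty
      show ?case by (intro exI[of _ 1]) auto
    next
      case (insert \<rho> J)
      then obtain d where d: "0 < d" "\<forall>\<rho>\<in>J. \<rho> (z - x) + ennreal d \<le> ennreal e" by auto
      have lt: "\<rho> (z - x) < ennreal e" using insert.prems by auto
      then obtain r where r: "\<rho> (z - x) = ennreal r" "0 \<le> r"
        by (cases "\<rho> (z - x)") auto
      then have re: "r < e" using lt by (simp add: ennreal_less_iff)
      have le: "ennreal r + ennreal (min d (e - r)) \<le> ennreal e"
        using r re d(1) by (simp add: ennreal_plus[symmetric] ennreal_leI del: ennreal_plus)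
      have "ennreal (min d (e - r)) \<le> ennreal d" by (simp add: ennreal_leI)
      then have "\<forall>\<rho>\<in>J. \<rho> (z - x) + ennreal (min d (e - r)) \<le> ennreal e"
        using d(2) by (meson add_left_mono order_trans)
      then show ?case
        using le r re d(1) by (intro exI[of _ "min d (e - r)"]) auto
    qed
    then obtain d where d: "0 < d" "\<forall>\<rho>\<in>J. \<rho> (z - x) + ennreal d \<le> ennreal e" by blast
    have "\<rho> (y - x) < ennreal e" if y: "\<forall>\<rho>\<in>J. \<rho> (y - z) < ennreal d" and \<rho>: "\<rho> \<in> J" for y \<rho>
    proof -
      have "\<rho> (y - x) \<le> \<rho> (z - x) + \<rho> (y - z)"
        using extended_seminorm_triangle[of s \<rho> "z - x" "y - z"] assms(2) J(1) \<rho> by auto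
      also have "\<dots> < \<rho> (z - x) + ennreal d"
      proof -
        have "\<rho> (z - x) \<noteq> top" using z \<rho> by force
        then show ?thesis using y \<rho> by (simp add: ennreal_add_left_cancel_less)
      qed
      also have "\<dots> \<le> ennreal e" using d \<rho> by blast
      finally show ?thesis .
    qed
    then show "\<exists>J' e'. J' \<subseteq> P \<and> finite J' \<and> 0 < (e'::real) \<and>
        {y. \<forall>\<rho>\<in>J'. \<rho> (y - z) < ennreal e'} \<subseteq> ?W"
      using J d(1) by (intro exI[of _ J] exI[of _ d] conjI) auto
  qed
  moreover have "x \<in> ?W"
  proof -
    have "\<rho> (x - x) < ennreal e" if "\<rho> \<in> J" for \<rho>
    proof -
      have "extended_seminorm s \<rho>" using that J(1) assms(2) by blast
      then have "\<rho> 0 = 0" by (rule extended_seminorm_zero[OF assms(1)])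
      then show ?thesis using J(3) by simp
    qed
    then show ?thesis by blast
  qed
  ultimately show "nbhd_in (seminorm_topology P) x N"
    using N unfolding nbhd_in_def by blast
qed

lemma continuous_map_uminus_seminorm_topology:
  assumes "vector_space s" "\<forall>\<rho>\<in>P. extended_seminorm s \<rho>"
  shows "continuous_map (seminorm_topology P) (seminorm_topology P) uminus"
  unfolding continuous_map_def topspace_seminorm_topology topspace_prod_topology Pi_UNIV
proof (rule conjI[OF UNIV_I], intro allI impI)
  fix W assume W: "openin (seminorm_topology P) W"
  have "\<exists>J e. J \<subseteq> P \<and> finite J \<and> 0 < (e::real) \<and> {y. \<forall>\<rho>\<in>J. \<rho> (y - x) < ennreal e} \<subseteq> {x. - x \<in> W}"
    if x: "- x \<in> W" for x
  proof -
    obtain J e where J: "J \<subseteq> P" "finite J" "0 < (e::real)" "{y. \<forall>\<rho>\<in>J. \<rho> (y - - x) < ennreal e} \<subseteq> W"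
      using W x by (rule openin_seminorm_topologyE)
    have "- y \<in> W" if "\<forall>\<rho>\<in>J. \<rho> (y - x) < ennreal e" for y
    proof -
      have "\<rho> (- y - - x) = \<rho> (y - x)" if "\<rho> \<in> J" for \<rho>
      proof -
        have "extended_seminorm s \<rho>" using assms(2) J(1) that by blast
        then have "\<rho> (- (y - x)) = \<rho> (y - x)" by (rule extended_seminorm_uminus[OF assms(1)])
        then show ?thesis by simp
      qed
      then have "\<rho> (- y - - x) < ennreal e" if "\<rho> \<in> J" for \<rho>
        using that \<open>\<forall>\<rho>\<in>J. \<rho> (y - x) < ennreal e\<close> by metis
      then have "- y \<in> {y. \<forall>\<rho>\<in>J. \<rho> (y - - x) < ennreal e}" by blast
      then show ?thesis using J(4) by (rule rev_subsetD)
    qed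
    then have "{y. \<forall>\<rho>\<in>J. \<rho> (y - x) < ennreal e} \<subseteq> {x. - x \<in> W}" by (intro Collect_mono impI)
    then show ?thesis using J(1-3) by (intro exI conjI)
  qed
  then show "openin (seminorm_topology P) {x \<in> UNIV. - x \<in> W}"
    unfolding openin_seminorm_topology by simp
qed

lemma continuous_map_add_seminorm_topology:
  assumes "vector_space s" "\<forall>\<rho>\<in>P. extended_seminorm s \<rho>"
  shows "continuous_map (prod_topology (seminorm_topology P) (seminorm_topology P))
           (seminorm_topology P) (\<lambda>(x, y). x + y)"
  unfolding continuous_map_def topspace_seminorm_topology topspace_prod_topology Pi_UNIV
proof (rule conjI[OF UNIV_I], intro allI impI)
  let ?T = "seminorm_topology P"
  fix W assume W: "openin ?T W"
  have "\<exists>A B. openin ?T A \<and> openin ?T B \<and> x \<in> A \<and> y \<in> B \<and> A \<times> B \<subseteq> {z. (case z of (x, y) \<Rightarrow> x + y) \<in> W}"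
    if xy: "x + y \<in> W" for x y
  proof -
    obtain J e where J: "J \<subseteq> P" "finite J" "0 < (e::real)"
      and sub: "{z. \<forall>\<rho>\<in>J. \<rho> (z - (x + y)) < ennreal e} \<subseteq> W"
      using W xy by (rule openin_seminorm_topologyE)
    have nb: "nbhd_in ?T u {v. \<forall>\<rho>\<in>J. \<rho> (v - u) < ennreal (e / 2)}" for u
      unfolding nbhd_in_seminorm_topology[OF assms]
      using J by (intro exI[of _ J] exI[of _ "e / 2"]) auto
    obtain A where A: "openin ?T A" "x \<in> A" "A \<subseteq> {v. \<forall>\<rho>\<in>J. \<rho> (v - x) < ennreal (e / 2)}"
      using nb unfolding nbhd_in_def by blast
    obtain B where B: "openin ?T B" "y \<in> B" "B \<subseteq> {v. \<forall>\<rho>\<in>J. \<rho> (v - y) < ennreal (e / 2)}"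
      using nb unfolding nbhd_in_def by blast
    have "a + b \<in> W" if "a \<in> A" "b \<in> B" for a b
    proof -
      have "\<rho> ((a + b) - (x + y)) < ennreal e" if \<rho>: "\<rho> \<in> J" for \<rho>
      proof -
        have "\<rho> ((a + b) - (x + y)) \<le> \<rho> (a - x) + \<rho> (b - y)"
          using extended_seminorm_triangle[of s \<rho> "a - x" "b - y"] assms(2) J(1) \<rho>
          by (auto simp: algebra_simps)
        also have "\<dots> < ennreal (e / 2 + e / 2)"
        proof (rule add_mono_ennreal)
          show "\<rho> (a - x) < ennreal (e / 2)" using A(3) \<open>a \<in> A\<close> \<rho> by blast
          show "\<rho> (b - y) < ennreal (e / 2)" using B(3) \<open>b \<in> B\<close> \<rho> by blast
        qed
        also have "\<dots> = ennreal e" by simp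
        finally show ?thesis .
      qed
      then show ?thesis using sub by auto
    qed
    then show ?thesis using A B by (intro exI[of _ A] exI[of _ B]) auto
  qed
  then show "openin (prod_topology ?T ?T)
      {z \<in> UNIV \<times> UNIV. (case z of (x, y) \<Rightarrow> x + y) \<in> W}"
    unfolding openin_prod_topology_alt by simp
qed

lemma flc_topology_exists:
  assumes "elcs s \<tau>"
  shows "\<exists>\<tau>F. flc_topology s \<tau> \<tau>F"
proof -
  obtain Q where vs: "vector_space s" and Q: "\<forall>\<rho>\<in>Q. extended_seminorm s \<rho>" "\<tau> = seminorm_topology Q"
    using assms unfolding elcs_def by blast
  define P where "P = {\<rho>. extended_seminorm s \<rho> \<and> (\<forall>x. \<rho> x < \<infinity>) \<and>
     (\<forall>e::real. 0 < e \<longrightarrow> nbhd_in \<tau> 0 {y. \<rho> y < ennreal e})}"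
  have small: "\<exists>K d. K \<subseteq> Q \<and> finite K \<and> 0 < (d::real) \<and>
      {y. \<forall>\<rho>\<in>K. \<rho> (y - x) < ennreal d} \<subseteq> {y. \<forall>\<rho>\<in>J. \<rho> (y - x) < ennreal e}"
    if "finite J" "J \<subseteq> P" "0 < (e::real)" for J e x
    using that
  proof (induction J)
    case empty
    show ?case by (intro exI[of _ "{}"] exI[of _ 1]) auto
  next
    case (insert p J)
    then obtain K d where K: "K \<subseteq> Q" "finite K" "0 < (d::real)"
      "{y. \<forall>\<rho>\<in>K. \<rho> (y - x) < ennreal d} \<subseteq> {y. \<forall>\<rho>\<in>J. \<rho> (y - x) < ennreal e}" by auto
    have "nbhd_in (seminorm_topology Q) 0 {y. p y < ennreal e}"
      using insert.prems unfolding P_def Q(2) by auto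
    then obtain L c where L: "L \<subseteq> Q" "finite L" "0 < (c::real)"
      "{y. \<forall>\<rho>\<in>L. \<rho> (y - 0) < ennreal c} \<subseteq> {y. p y < ennreal e}"
      unfolding nbhd_in_seminorm_topology[OF vs Q(1)] by (elim exE conjE)
    have le: "ennreal (min d c) \<le> ennreal d" "ennreal (min d c) \<le> ennreal c"
      by (auto intro: ennreal_leI)
    have "\<forall>\<rho>\<in>insert p J. \<rho> (y - x) < ennreal e"
      if y: "\<forall>\<rho>\<in>K \<union> L. \<rho> (y - x) < ennreal (min d c)" for y
    proof -
      have "\<forall>\<rho>\<in>K. \<rho> (y - x) < ennreal d" "\<forall>\<rho>\<in>L. \<rho> (y - x) < ennreal c"
        using y le by (auto intro: less_le_trans)
      then show ?thesis using K(4) L(4) by auto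
    qed
    then show ?case
      using K(1-3) L(1-3) by (intro exI[of _ "K \<union> L"] exI[of _ "min d c"] conjI) auto
  qed
  have "locally_convex_topology s (seminorm_topology P)"
    unfolding locally_convex_topology_def by (intro exI[of _ P]) (auto simp: P_def)
  moreover have "coarser (seminorm_topology P) \<tau>"
    unfolding coarser_def
  proof (intro allI impI)
    fix W assume W: "openin (seminorm_topology P) W"
    show "openin \<tau> W"
      unfolding Q(2) openin_seminorm_topology
    proof
      fix x assume "x \<in> W"
      with W obtain J e where J: "J \<subseteq> P" "finite J" "0 < (e::real)"
        and sub: "{y. \<forall>\<rho>\<in>J. \<rho> (y - x) < ennreal e} \<subseteq> W"
        by (rule openin_seminorm_topologyE)
      from small[OF J(2,1,3), of x] obtain K d where K: "K \<subseteq> Q" "finite K" "0 < (d::real)"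
        "{y. \<forall>\<rho>\<in>K. \<rho> (y - x) < ennreal d} \<subseteq> {y. \<forall>\<rho>\<in>J. \<rho> (y - x) < ennreal e}"
        by (elim exE conjE)
      have "{y. \<forall>\<rho>\<in>K. \<rho> (y - x) < ennreal d} \<subseteq> W"
        using K(4) sub by (rule order_trans)
      then show "\<exists>J e. J \<subseteq> Q \<and> finite J \<and> 0 < (e::real) \<and> {y. \<forall>\<rho>\<in>J. \<rho> (y - x) < ennreal e} \<subseteq> W"
        using K(1-3) by (intro exI conjI)
    qed
  qed
  moreover have "coarser \<sigma> (seminorm_topology P)"
    if \<sigma>: "locally_convex_topology s \<sigma>" "coarser \<sigma> \<tau>" for \<sigma>
  proof -
    obtain R where R: "\<forall>\<rho>\<in>R. extended_seminorm s \<rho> \<and> (\<forall>x. \<rho> x < \<infinity>)" "\<sigma> = seminorm_topology R"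
      using \<sigma>(1) unfolding locally_convex_topology_def by blast
    have "R \<subseteq> P"
    proof
      fix \<rho> assume \<rho>: "\<rho> \<in> R"
      have "nbhd_in \<tau> 0 {y. \<rho> y < ennreal e}" if "0 < e" for e :: real
      proof -
        have "nbhd_in \<sigma> 0 {y. \<rho> y < ennreal e}"
          unfolding R(2) using \<rho> that vs R(1)
          by (subst nbhd_in_seminorm_topology[of s]) (auto intro!: exI[of _ "{\<rho>}"] exI[of _ e])
        then show ?thesis using \<sigma>(2) unfolding nbhd_in_def coarser_def by blast
      qed
      then show "\<rho> \<in> P" using R(1) \<rho> by (auto simp: P_def)
    qed
    show ?thesis
      unfolding coarser_def R(2)
    proof (intro allI impI)
      fix W assume W: "openin (seminorm_topology R) W"
      show "openin (seminorm_topology P) W"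
        unfolding openin_seminorm_topology
      proof
        fix x assume "x \<in> W"
        with W obtain J e where J: "J \<subseteq> R" "finite J" "0 < (e::real)"
          "{y. \<forall>\<rho>\<in>J. \<rho> (y - x) < ennreal e} \<subseteq> W"
          by (rule openin_seminorm_topologyE)
        moreover have "J \<subseteq> P"
          using J(1) \<open>R \<subseteq> P\<close> by (rule order_trans)
        ultimately show "\<exists>J e. J \<subseteq> P \<and> finite J \<and> 0 < (e::real) \<and>
            {y. \<forall>\<rho>\<in>J. \<rho> (y - x) < ennreal e} \<subseteq> W"
          by (intro exI conjI)
      qed
    qed
  qed
  ultimately show ?thesis
    unfolding flc_topology_def by blast
qed

lemma flc_topology_unique:
  assumes "flc_topology s \<tau> \<sigma>" "flc_topology s \<tau> \<sigma>'"
  shows "\<sigma> = \<sigma>'"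
proof -
  have "coarser \<sigma> \<sigma>'" "coarser \<sigma>' \<sigma>"
    using assms by (simp_all add: flc_topology_def)
  then show ?thesis
    unfolding coarser_def topology_eq by (intro allI iffI) simp_all
qed

end

theory Submission
  imports Defs
begin

text \<open>
  Everything is read off from the Minkowski functional \<open>p\<close> of \<open>U\<close>. For an absolutely convex set
  containing 0 it is an extended seminorm, and 0 is in the core of \<open>U\<close> exactly when \<open>p\<close> is finite
  everywhere (\<open>zero_in_core_iff_minkowski_finite\<close>). Since \<open>U\<close> is a \<open>\<tau>\<close>-neighbourhood of 0, the
  topology induced by \<open>p\<close> alone is coarser than \<open>\<tau>\<close>.

  Core and \<open>\<tau>F\<close>-neighbourhoods. If \<open>p\<close> is finite, its topology is locally convex and coarser
  than \<open>\<tau>\<close>, so it is coarser than \<open>\<tau>F\<close>, and \<open>{p < 1} \<subseteq> U\<close> is then a \<open>\<tau>F\<close>-neighbourhood of 0.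
  Conversely, \<open>\<tau>F\<close> is induced by finite seminorms, so every one of its neighbourhoods of 0 absorbs
  every vector.

  Core implies compact polar. This is the Banach--Alaoglu argument. The weak-star topology is the
  subspace topology of the product topology on the functions \<open>'x \<Rightarrow> 'k\<close>. A linear functional bounded
  by 1 on \<open>U\<close> is automatically \<open>\<tau>\<close>-continuous, so the polar is cut out by closed pointwise
  conditions; if \<open>U\<close> absorbs every point, it lies in a product of closed balls, which is compact by
  Tychonoff.

  Compact polar implies core. If \<open>p x = \<infinity>\<close> for some \<open>x\<close>, then \<open>x\<close> lies outside the subspace
  \<open>{p < \<infinity>} \<supseteq> U\<close>. Extending a basis of this subspace gives a linear functional \<open>f\<close> that vanishes on it
  with \<open>f x = 1\<close>, and \<open>f\<close> is continuous however large it is off the subspace, because it vanishes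
  on the neighbourhood \<open>U\<close>. All multiples of \<open>f\<close> vanish on \<open>U\<close>, so they belong to the polar, and evaluation at \<open>x\<close>
  is unbounded on it. This contradicts compactness.
\<close>

section \<open>The Minkowski functional\<close>

text \<open>The infimum is taken in \<open>ennreal\<close>, so that it is \<open>\<infinity>\<close> at the points that no positive multiple of \<open>U\<close>
  contains.\<close>

definition minkowski :: "('k::real_normed_field \<Rightarrow> 'x::ab_group_add \<Rightarrow> 'x) \<Rightarrow> 'x set \<Rightarrow> 'x \<Rightarrow> ennreal" where
  "minkowski s U x = Inf (ennreal ` {t. 0 < t \<and> s (of_real (inverse t)) x \<in> U})"

lemma absolutely_convexD_scale:
  "absolutely_convex s U \<Longrightarrow> x \<in> U \<Longrightarrow> norm a \<le> 1 \<Longrightarrow> s a x \<in> U"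
  by (simp add: absolutely_convex_def)

lemma minkowski_le:
  assumes "0 < t" "s (of_real (inverse t)) x \<in> U"
  shows "minkowski s U x \<le> ennreal t"
  unfolding minkowski_def using assms by (intro Inf_lower) auto

text \<open>The infimum need not be attained, so membership follows only from a strict bound: a smaller
  admissible \<open>t\<close> gives \<open>x/t \<in> U\<close>, and \<open>x/r\<close> is \<open>x/t\<close> times \<open>t/r < 1\<close>.\<close>

lemma minkowski_less_imp_mem:
  assumes "vector_space s" "absolutely_convex s U" "minkowski s U x < ennreal r"
  shows "s (of_real (inverse r)) x \<in> U"
proof -
  interpret vector_space s by fact
  obtain t where t: "0 < t" "s (of_real (inverse t)) x \<in> U" "t < r"
    using assms(3) unfolding minkowski_def Inf_less_iff by (auto simp: ennreal_less_iff)
  have "s (of_real (t / r)) (s (of_real (inverse t)) x) \<in> U"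
    by (rule absolutely_convexD_scale[OF assms(2) t(2)]) (use t in \<open>simp add: norm_divide\<close>)
  also have "s (of_real (t / r)) (s (of_real (inverse t)) x) = s (of_real (inverse r)) x"
    using t by (simp add: field_simps)
  finally show ?thesis .
qed

lemma minkowski_finite_iff:
  "minkowski s U x < \<infinity> \<longleftrightarrow> (\<exists>d>0. s (of_real d) x \<in> U)"
proof
  assume "minkowski s U x < \<infinity>"
  then obtain t where "0 < t" "s (of_real (inverse t)) x \<in> U"
    unfolding minkowski_def Inf_less_iff by auto
  then show "\<exists>d>0. s (of_real d) x \<in> U"
    by (intro exI[of _ "inverse t"]) auto
next
  assume "\<exists>d>0. s (of_real d) x \<in> U"
  then obtain d where "0 < d" "s (of_real d) x \<in> U" by blast
  then have "minkowski s U x \<le> ennreal (inverse d)"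
    by (intro minkowski_le) auto
  then show "minkowski s U x < \<infinity>"
    using le_less_trans[OF _ ennreal_less_top] by (simp add: infinity_ennreal_def)
qed

text \<open>Both seminorm laws come from inflating finite values slightly so that the infima can be
  replaced by memberships. In the homogeneity law, each inequality is the other one for the
  inverse scalar.\<close>

lemma extended_seminorm_minkowski:
  assumes vs: "vector_space s" and ac: "absolutely_convex s U" and zero: "0 \<in> U"
  shows "extended_seminorm s (minkowski s U)"
proof -
  interpret vector_space s by fact
  let ?p = "minkowski s U"
  have le: "?p (s a x) \<le> ennreal (norm a) * ?p x" if "a \<noteq> 0" for a x
  proof (rule ennreal_le_epsilon)
    fix e :: real
    assume fin: "ennreal (norm a) * ?p x < top" and e: "0 < e"
    obtain c where c: "?p x = ennreal c" "0 \<le> c"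
      using fin \<open>a \<noteq> 0\<close> by (cases "?p x") (auto simp: ennreal_mult_top)
    \<comment> \<open>The slack is \<open>e / norm a\<close>, because it is multiplied by \<open>norm a\<close> at the end.\<close>
    define r where "r = c + e / norm a"
    have na: "0 < norm a" using that by simp
    have r: "0 < r" "c < r" using c(2) e na by (auto simp: r_def intro: add_nonneg_pos)
    have xU: "s (of_real (inverse r)) x \<in> U"
      using r c by (intro minkowski_less_imp_mem[OF vs ac]) (simp add: ennreal_less_iff)
    have "s (a / of_real (norm a)) (s (of_real (inverse r)) x) \<in> U"
      by (rule absolutely_convexD_scale[OF ac xU]) (simp add: norm_divide)
    also have "s (a / of_real (norm a)) (s (of_real (inverse r)) x)
        = s (of_real (inverse (norm a * r))) (s a x)"
      by (simp add: field_simps)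
    finally have "?p (s a x) \<le> ennreal (norm a * r)"
      using na r by (intro minkowski_le) auto
    also have "norm a * r = norm a * c + e"
      using na by (simp add: r_def field_simps)
    also have "ennreal \<dots> = ennreal (norm a) * ?p x + ennreal e"
      using c e by (simp add: ennreal_mult)
    finally show "?p (s a x) \<le> ennreal (norm a) * ?p x + ennreal e" .
  qed
  have p0: "?p 0 = 0"
  proof -
    have "?p 0 \<le> 0 + ennreal e" if "0 < e" for e
      using that zero by (simp add: minkowski_le)
    then show ?thesis
      by (metis ennreal_le_epsilon le_zero_eq)
  qed
  have homogeneous: "?p (s a x) = ennreal (norm a) * ?p x" for a x
  proof (cases "a = 0")
    case False
    have "ennreal (norm a) * ?p x = ennreal (norm a) * ?p (s (inverse a) (s a x))"
      using False by simp
    also have "\<dots> \<le> ennreal (norm a) * (ennreal (norm (inverse a)) * ?p (s a x))"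
      using False by (intro mult_left_mono le) auto
    also have "\<dots> = ?p (s a x)"
      using False by (simp add: norm_inverse flip: mult.assoc ennreal_mult)
    finally show ?thesis
      using le[OF False] by (rule antisym[rotated])
  qed (simp add: p0)
  have "?p (x + y) \<le> ?p x + ?p y" for x y
  proof (rule ennreal_le_epsilon)
    fix e :: real
    assume fin: "?p x + ?p y < top" and e: "0 < e"
    obtain a where a: "?p x = ennreal a" "0 \<le> a" using fin by (cases "?p x") auto
    obtain b where b: "?p y = ennreal b" "0 \<le> b" using fin by (cases "?p y") auto
    define a' b' where "a' = a + e / 2" and "b' = b + e / 2"
    have pos: "0 < a'" "0 < b'" using a b e by (auto simp: a'_def b'_def)
    have "s (of_real (inverse a')) x \<in> U" "s (of_real (inverse b')) y \<in> U"
      by (rule minkowski_less_imp_mem[OF vs ac], use a b e in \<open>simp add: a'_def b'_def ennreal_less_iff del: ennreal_plus\<close>)+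
    \<comment> \<open>With this weight the convex combination of \<open>x/a'\<close> and \<open>y/b'\<close> is \<open>(x + y)/(a' + b')\<close>.\<close>
    moreover define t where "t = b' / (a' + b')"
    have t: "0 \<le> t" "t \<le> 1" using pos by (auto simp: t_def)
    ultimately have "s (of_real (1 - t)) (s (of_real (inverse a')) x)
        + s (of_real t) (s (of_real (inverse b')) y) \<in> U"
      using ac unfolding absolutely_convex_def by blast
    then have "s (of_real ((1 - t) * inverse a')) x + s (of_real (t * inverse b')) y \<in> U"
      by (simp only: scale_scale of_real_mult)
    moreover have "(1 - t) * inverse a' = inverse (a' + b')" "t * inverse b' = inverse (a' + b')"
      using pos by (auto simp: t_def field_simps)
    ultimately have "s (of_real (inverse (a' + b'))) (x + y) \<in> U"
      by (simp only: scale_right_distrib)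
    then have "?p (x + y) \<le> ennreal (a' + b')"
      using pos by (intro minkowski_le) auto
    also have "a' + b' = a + b + e" by (simp add: a'_def b'_def)
    also have "ennreal \<dots> = ?p x + ?p y + ennreal e"
      using a b e by simp
    finally show "?p (x + y) \<le> ?p x + ?p y + ennreal e" .
  qed
  with homogeneous show ?thesis
    by (simp add: extended_seminorm_def)
qed

lemma zero_in_core_iff_minkowski_finite:
  assumes vs: "vector_space s" and ac: "absolutely_convex s U"
  shows "zero_in_core s U \<longleftrightarrow> (\<forall>x. minkowski s U x < \<infinity>)"
proof -
  interpret vector_space s by fact
  have "s (of_real t) x \<in> U" if "0 < d" "s (of_real d) x \<in> U" "0 \<le> t" "t \<le> d" for d t x
  proof -
    have "s (of_real (t / d)) (s (of_real d) x) \<in> U"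
      by (rule absolutely_convexD_scale[OF ac that(2)]) (use that in \<open>simp add: norm_divide\<close>)
    then show ?thesis using that by simp
  qed
  then show ?thesis
    unfolding zero_in_core_def minkowski_finite_iff by (meson less_imp_le order_refl)
qed

lemma subspace_finite_extended_seminorm:
  assumes "vector_space s" "extended_seminorm s \<rho>"
  shows "module.subspace s {x. \<rho> x < \<infinity>}"
proof -
  interpret vector_space s by fact
  show ?thesis
  proof (rule subspaceI)
    show "0 \<in> {x. \<rho> x < \<infinity>}"
      using extended_seminorm_zero[OF assms] by simp
  next
    fix x y assume "x \<in> {x. \<rho> x < \<infinity>}" "y \<in> {x. \<rho> x < \<infinity>}"
    then show "x + y \<in> {x. \<rho> x < \<infinity>}"
      using extended_seminorm_triangle[OF assms(2), of x y] by (auto intro: le_less_trans)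
  next
    fix a x assume "x \<in> {x. \<rho> x < \<infinity>}"
    then show "s a x \<in> {x. \<rho> x < \<infinity>}"
      using assms(2) by (simp add: extended_seminorm_def ennreal_mult_less_top)
  qed
qed


section \<open>Neighbourhoods of zero and continuity\<close>

text \<open>Multiples of a neighbourhood of 0 are again neighbourhoods of 0, in terms of basic sets. This
  gives continuity statements at every scale from the single neighbourhood \<open>U\<close>.\<close>

lemma seminorm_topology_nbhd_scale:
  assumes vs: "vector_space s" and P: "\<forall>\<rho>\<in>P. extended_seminorm s \<rho>"
    and U: "nbhd_in (seminorm_topology P) 0 U" and r: "0 < r"
  obtains J d where "J \<subseteq> P" "finite J" "0 < (d::real)"
    "\<And>z. \<forall>\<rho>\<in>J. \<rho> z < ennreal d \<Longrightarrow> s (of_real (inverse r)) z \<in> U"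
proof -
  obtain J e where J: "J \<subseteq> P" "finite J" "0 < (e::real)" "{y. \<forall>\<rho>\<in>J. \<rho> y < ennreal e} \<subseteq> U"
    using U unfolding nbhd_in_seminorm_topology[OF vs P] by auto
  show thesis
  proof (rule that)
    show "0 < r * e" using r J by simp
    fix z assume z: "\<forall>\<rho>\<in>J. \<rho> z < ennreal (r * e)"
    have "\<rho> (s (of_real (inverse r)) z) < ennreal e" if \<rho>: "\<rho> \<in> J" for \<rho>
    proof -
      have es: "extended_seminorm s \<rho>" using P J(1) \<rho> by blast
      obtain c where c: "\<rho> z = ennreal c" "0 \<le> c" "c < r * e"
        using bspec[OF z \<rho>] by (cases "\<rho> z") (auto simp: ennreal_less_iff)
      have "\<rho> (s (of_real (inverse r)) z) = ennreal (inverse r) * \<rho> z"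
        using es r by (simp add: extended_seminorm_def norm_inverse)
      also have "\<dots> = ennreal (inverse r * c)"
        using c r by (simp add: ennreal_mult)
      also have "\<dots> < ennreal e"
        using c r J(3) by (intro ennreal_lessI) (auto simp: field_simps)
      finally show ?thesis .
    qed
    then show "s (of_real (inverse r)) z \<in> U" using J(4) by blast
  qed (use J in auto)
qed

text \<open>The Minkowski functional of a neighbourhood of 0 is continuous: it is at most \<open>e/2\<close> on
  \<open>(e/2) U\<close>.\<close>

lemma coarser_minkowski_topology:
  assumes vs: "vector_space s" and P: "\<forall>\<rho>\<in>P. extended_seminorm s \<rho>"
    and U: "nbhd_in (seminorm_topology P) 0 U"
  shows "coarser (seminorm_topology {minkowski s U}) (seminorm_topology P)"
  unfolding coarser_def
proof (intro allI impI)
  fix W assume W: "openin (seminorm_topology {minkowski s U}) W"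
  show "openin (seminorm_topology P) W"
    unfolding openin_seminorm_topology
  proof
    fix x assume "x \<in> W"
    with W obtain K e where K: "K \<subseteq> {minkowski s U}" "0 < (e::real)"
        "{y. \<forall>\<rho>\<in>K. \<rho> (y - x) < ennreal e} \<subseteq> W"
      by (rule openin_seminorm_topologyE)
    have e2: "0 < e / 2" using K by simp
    obtain J d where J: "J \<subseteq> P" "finite J" "0 < (d::real)"
      "\<And>z. \<forall>\<rho>\<in>J. \<rho> z < ennreal d \<Longrightarrow> s (of_real (inverse (e / 2))) z \<in> U"
      using seminorm_topology_nbhd_scale[OF vs P U e2] by blast
    have "y \<in> W" if y: "\<forall>\<rho>\<in>J. \<rho> (y - x) < ennreal d" for y
    proof -
      have "minkowski s U (y - x) \<le> ennreal (e / 2)"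
        using J(4)[OF y] e2 by (intro minkowski_le)
      also have "\<dots> < ennreal e" using K by (intro ennreal_lessI) auto
      finally show ?thesis using K by blast
    qed
    then show "\<exists>J e. J \<subseteq> P \<and> finite J \<and> 0 < (e::real) \<and> {y. \<forall>\<rho>\<in>J. \<rho> (y - x) < ennreal e} \<subseteq> W"
      using J(1-3) by (intro exI[of _ J] exI[of _ d]) auto
  qed
qed

text \<open>By linearity, a bound by 1 on \<open>U\<close> is a bound by \<open>r/2\<close> on \<open>(r/2) U\<close>, and translation
  carries this from 0 to any other point.\<close>

lemma bounded_on_nbhd_imp_dual:
  assumes \<tau>: "elcs s \<tau>" and U: "nbhd_in \<tau> 0 U"
    and lin: "Vector_Spaces.linear s (*) f" and bd: "\<And>x. x \<in> U \<Longrightarrow> norm (f x) \<le> 1"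
  shows "f \<in> dual s \<tau>"
proof -
  obtain P where vs: "vector_space s" and P: "\<forall>\<rho>\<in>P. extended_seminorm s \<rho>"
    and \<tau>_eq: "\<tau> = seminorm_topology P"
    using \<tau> unfolding elcs_def by blast
  interpret Vector_Spaces.linear s "(*)" f by fact
  have "openin \<tau> {x. f x \<in> W}" if W: "open W" for W
    unfolding \<tau>_eq openin_seminorm_topology
  proof
    fix x assume "x \<in> {x. f x \<in> W}"
    with W obtain r where r: "0 < r" "ball (f x) r \<subseteq> W"
      by (auto simp: open_contains_ball)
    then have r2: "0 < r / 2" by simp
    obtain J d where J: "J \<subseteq> P" "finite J" "0 < (d::real)"
      "\<And>z. \<forall>\<rho>\<in>J. \<rho> z < ennreal d \<Longrightarrow> s (of_real (inverse (r / 2))) z \<in> U"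
      using seminorm_topology_nbhd_scale[OF vs P U[unfolded \<tau>_eq] r2] by blast
    have "f y \<in> W" if y: "\<forall>\<rho>\<in>J. \<rho> (y - x) < ennreal d" for y
    proof -
      have "norm (f (s (of_real (inverse (r / 2))) (y - x))) \<le> 1"
        using bd J(4)[OF y] by blast
      also have "f (s (of_real (inverse (r / 2))) (y - x)) = of_real (inverse (r / 2)) * (f y - f x)"
        by (simp add: scale diff)
      also have "norm \<dots> = inverse (r / 2) * norm (f y - f x)"
        unfolding norm_mult norm_of_real using r by simp
      finally have "norm (f y - f x) \<le> r / 2"
        using r by (simp add: field_simps)
      then have "f y \<in> ball (f x) r"
        using r by (simp add: dist_norm norm_minus_commute)
      then show ?thesis using r by blast
    qed
    then show "\<exists>J e. J \<subseteq> P \<and> finite J \<and> 0 < (e::real) \<and>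
        {y. \<forall>\<rho>\<in>J. \<rho> (y - x) < ennreal e} \<subseteq> {x. f x \<in> W}"
      using J(1-3) by (intro exI[of _ J] exI[of _ d]) auto
  qed
  then show ?thesis
    using lin by (simp add: dual_def continuous_map_def \<tau>_eq)
qed

text \<open>The polar of a neighbourhood of 0 is described by pointwise conditions only: continuity,
  which pointwise limits need not preserve, follows from the others.\<close>

lemma polar_eq_bounded_linear:
  assumes "elcs s \<tau>" "nbhd_in \<tau> 0 U"
  shows "polar s \<tau> U = {f. Vector_Spaces.linear s (*) f \<and> (\<forall>x\<in>U. norm (f x) \<le> 1)}"
  using bounded_on_nbhd_imp_dual[OF assms] by (auto simp: polar_def dual_def)


section \<open>Compactness in the weak-star topology\<close>

text \<open>Compactness is transported from \<open>real\<close> or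
  \<open>complex\<close> along the inverse of the additive isometry that the class provides.\<close>

lemma compact_cball_real_or_complex:
  "compact (cball (0::'k::real_or_complex) r)"
proof -
  have *: "compact (cball (0::'k) r)"
    if bij: "bij \<phi>" and add: "\<forall>x y. \<phi> (x + y) = \<phi> x + \<phi> y" and norm: "\<forall>x. norm (\<phi> x) = norm x"
    for \<phi> :: "'k \<Rightarrow> 'b::{real_normed_vector, heine_borel}"
  proof -
    have surj: "\<phi> (inv \<phi> y) = y" for y
      using bij by (simp add: bij_is_surj surj_f_inv_f)
    have diff: "\<phi> (x - y) = \<phi> x - \<phi> y" for x y
      using add[rule_format, of "x - y" y] by simp
    have "dist (inv \<phi> x) (inv \<phi> y) = dist x y" for x y
      using norm[rule_format, of "inv \<phi> x - inv \<phi> y"] by (simp add: dist_norm diff surj)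
    then have "continuous_on (cball 0 r) (inv \<phi>)"
      by (auto simp: continuous_on_iff)
    then have "compact (inv \<phi> ` cball 0 r)"
      by (intro compact_continuous_image) auto
    also have "inv \<phi> ` cball 0 r = cball 0 r"
    proof -
      have "x \<in> inv \<phi> ` cball 0 r" if "norm x \<le> r" for x
        using that norm bij by (intro image_eqI[of _ _ "\<phi> x"]) (auto simp: bij_is_inj inv_f_f)
      moreover have "norm (inv \<phi> y) = norm y" for y
        using norm[rule_format, of "inv \<phi> y"] by (simp add: surj)
      ultimately show ?thesis by auto
    qed
    finally show ?thesis .
  qed
  show ?thesis
    using real_or_complex[where 'a='k] by (elim disjE exE conjE) (use * in blast)+
qed

text \<open>The topology of the function type is the product topology, so this identifies weak-star
  convergence with pointwise convergence and makes Tychonoff's theorem applicable.\<close>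

lemma weak_star_eq_top_of_set:
  fixes s :: "'k::real_normed_field \<Rightarrow> 'x::ab_group_add \<Rightarrow> 'x"
  shows "weak_star s \<tau> = top_of_set (dual s \<tau>)"
  unfolding topology_eq
proof (intro allI iffI)
  fix W assume W: "openin (weak_star s \<tau>) W"
  show "openin (top_of_set (dual s \<tau>)) W"
  proof (subst openin_subopen, intro ballI)
    fix f assume f: "f \<in> W"
    then obtain F e where F: "finite F" "0 < (e::real)"
      "{g \<in> dual s \<tau>. \<forall>x\<in>F. norm (g x - f x) < e} \<subseteq> W"
      using W unfolding openin_weak_star by meson
    have "open {g :: 'x \<Rightarrow> 'k. norm (g x - f x) < e}" for x
      by (intro open_Collect_less continuous_intros continuous_on_product_coordinates)
    then have "open (\<Inter>x\<in>F. {g. norm (g x - f x) < e})"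
      using F(1) by (intro open_INT) auto
    then have "openin (top_of_set (dual s \<tau>)) (dual s \<tau> \<inter> (\<Inter>x\<in>F. {g. norm (g x - f x) < e}))"
      by (rule openin_open_Int)
    moreover have "f \<in> dual s \<tau>" using W f unfolding openin_weak_star by blast
    ultimately show "\<exists>T. openin (top_of_set (dual s \<tau>)) T \<and> f \<in> T \<and> T \<subseteq> W"
      using F by (intro exI[of _ "dual s \<tau> \<inter> (\<Inter>x\<in>F. {g. norm (g x - f x) < e})"] conjI) auto
  qed
next
  fix W assume "openin (top_of_set (dual s \<tau>)) W"
  then obtain T where T: "open T" "W = dual s \<tau> \<inter> T"
    unfolding openin_open by blast
  have "\<exists>F e. finite F \<and> 0 < (e::real) \<and> {g \<in> dual s \<tau>. \<forall>x\<in>F. norm (g x - f x) < e} \<subseteq> W"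
    if f: "f \<in> W" for f
  proof -
    have "openin (product_topology (\<lambda>_. euclidean) UNIV) T" "f \<in> T"
      using T f by (auto simp: euclidean_product_topology)
    then obtain X where X: "f \<in> PiE UNIV X" "\<And>x. open (X x)"
        "finite {x. X x \<noteq> UNIV}" "PiE UNIV X \<subseteq> T"
      using product_topology_open_contains_basis[of "\<lambda>_. euclidean" UNIV T f] by auto
    let ?F = "{x. X x \<noteq> UNIV}"
    have "\<exists>r>0. ball (f x) r \<subseteq> X x" for x
      using X(1,2) by (auto simp: open_contains_ball)
    then obtain r where r: "\<And>x. 0 < r x" "\<And>x. ball (f x) (r x) \<subseteq> X x" by metis
    \<comment> \<open>The extra 1 keeps the minimum defined when no coordinate is constrained.\<close>
    define e where "e = Min (insert 1 (r ` ?F))"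
    have e: "0 < e" "\<And>x. x \<in> ?F \<Longrightarrow> e \<le> r x"
      using X(3) r(1) by (auto simp: e_def)
    have "g \<in> T" if g: "\<forall>x\<in>?F. norm (g x - f x) < e" for g
    proof -
      have "g x \<in> X x" for x
      proof (cases "x \<in> ?F")
        case True
        then have "dist (f x) (g x) < r x"
          using g e(2) by (fastforce simp: dist_norm norm_minus_commute)
        then show ?thesis using r(2)[of x] by auto
      qed simp
      then show ?thesis using X(4) by auto
    qed
    then show ?thesis
      using X(3) e(1) T(2) by (intro exI[of _ ?F] exI[of _ e]) auto
  qed
  then show "openin (weak_star s \<tau>) W"
    using T(2) by (simp add: openin_weak_star)
qed

lemma compactin_weak_star_polar_iff:
  "compactin (weak_star s \<tau>) (polar s \<tau> U) \<longleftrightarrow> compact (polar s \<tau> U)"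
  by (auto simp: weak_star_eq_top_of_set compactin_subtopology polar_def)

text \<open>The Banach--Alaoglu theorem. The core condition gives \<open>d x > 0\<close> with \<open>d x * x \<in> U\<close>, which
  bounds \<open>norm (f x)\<close> by \<open>1 / d x\<close> for all \<open>f\<close> in the polar.\<close>

lemma compact_polar:
  fixes s :: "'k::real_or_complex \<Rightarrow> 'x::ab_group_add \<Rightarrow> 'x"
  assumes \<tau>: "elcs s \<tau>" and U: "nbhd_in \<tau> 0 U" and core: "zero_in_core s U"
  shows "compact (polar s \<tau> U)"
proof -
  have vs: "vector_space s" using \<tau> by (simp add: elcs_def)
  have "\<exists>d>0. s (of_real d) x \<in> U" for x
    using core unfolding zero_in_core_def by (metis less_imp_le order_refl)
  then obtain d where d: "\<And>x. 0 < d x" "\<And>x. s (of_real (d x)) x \<in> U" by metis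
  let ?B = "PiE UNIV (\<lambda>x. cball (0::'k) (inverse (d x)))"
  let ?C = "{f. (\<forall>x y. f (x + y) = f x + f y) \<and> (\<forall>a x. f (s a x) = a * f x) \<and> (\<forall>x\<in>U. norm (f x) \<le> 1)}"
  have "compactin (product_topology (\<lambda>_. euclidean) UNIV) ?B"
    by (simp add: compactin_PiE compact_cball_real_or_complex)
  then have "compact ?B"
    by (simp add: euclidean_product_topology)
  moreover have "closed ?C"
  proof -
    have eval: "continuous_on UNIV (\<lambda>f :: 'x \<Rightarrow> 'k. f x)" for x
      by (rule continuous_on_product_coordinates)
    have "closed {f :: 'x \<Rightarrow> 'k. f (x + y) = f x + f y}" for x y
      by (rule closed_Collect_eq[OF eval continuous_on_add[OF eval eval]])
    moreover have "closed {f :: 'x \<Rightarrow> 'k. f (s a x) = a * f x}" for a x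
      by (rule closed_Collect_eq[OF eval continuous_on_mult_left[OF eval]])
    moreover have "closed {f :: 'x \<Rightarrow> 'k. norm (f x) \<le> 1}" for x
      by (rule closed_Collect_le[OF continuous_on_norm[OF eval] continuous_on_const])
    ultimately show ?thesis
      unfolding Ball_def
      by (intro closed_Collect_conj closed_Collect_all closed_Collect_imp open_Collect_const)
  qed
  moreover have "polar s \<tau> U = ?B \<inter> ?C"
  proof -
    have lin_iff: "Vector_Spaces.linear s (*) f \<longleftrightarrow>
        (\<forall>x y. f (x + y) = f x + f y) \<and> (\<forall>a x. f (s a x) = a * f x)" for f :: "'x \<Rightarrow> 'k"
      using vs vector_space_over_itself.vector_space_axioms
      by (auto simp: Vector_Spaces.linear_iff)
    have "f \<in> ?B" if f: "f \<in> ?C" for f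
    proof -
      have "norm (f x) \<le> inverse (d x)" for x
      proof -
        have "norm (f (s (of_real (d x)) x)) \<le> 1" using f d(2) by blast
        moreover have "f (s (of_real (d x)) x) = of_real (d x) * f x" using f by blast
        ultimately have "d x * norm (f x) \<le> 1"
          using d(1)[of x] by (simp add: norm_mult)
        then show ?thesis using d(1)[of x] by (simp add: field_simps)
      qed
      then show ?thesis by auto
    qed
    then have "?B \<inter> ?C = ?C" by blast
    then show ?thesis
      unfolding polar_eq_bounded_linear[OF \<tau> U] lin_iff by auto
  qed
  ultimately show ?thesis
    by (simp add: compact_Int_closed)
qed


section \<open>Boundedness forces zero into the core\<close>

text \<open>A basis of \<open>M\<close> together with \<open>x\<close> is still independent, so the values on it can be
  prescribed.\<close>

lemma linear_functional_separating_subspace: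
  fixes s :: "'k::field \<Rightarrow> 'x::ab_group_add \<Rightarrow> 'x"
  assumes vs: "vector_space s" and M: "module.subspace s M" and x: "x \<notin> M"
  obtains f where "Vector_Spaces.linear s (*) f" "f x = 1" "\<And>y. y \<in> M \<Longrightarrow> f y = 0"
proof -
  interpret vector_space s by fact
  interpret vector_space_pair s "(*) :: 'k \<Rightarrow> 'k \<Rightarrow> 'k"
    using vs vector_space_over_itself.vector_space_axioms by (simp add: vector_space_pair_def)
  obtain B where B: "B \<subseteq> M" "independent B" "M \<subseteq> span B"
    using maximal_independent_subset by blast
  have "x \<notin> span B" using span_minimal[OF B(1) M] x by blast
  then have indep: "independent (insert x B)" and "x \<notin> B"
    using B(2) independent_insertI span_base by blast+
  obtain f where f: "Vector_Spaces.linear s (*) f" "\<forall>y\<in>insert x B. f y = (if y = x then 1 else 0)"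
    using linear_independent_extend[OF indep, of "\<lambda>y. if y = x then 1 else 0"] by blast
  have "f y = 0" if "y \<in> M" for y
    by (rule linear_eq_0_on_span[OF f(1), of B]) (use f \<open>x \<notin> B\<close> B(3) that in auto)
  with f show thesis by (intro that[of f]) auto
qed

text \<open>The polar contains every linear functional that vanishes on the subspace spanned by \<open>U\<close>. If
  this subspace is proper, such functionals have arbitrarily large values at a point outside it.\<close>

lemma zero_in_core_if_compact_polar:
  assumes \<tau>: "elcs s \<tau>" and ac: "absolutely_convex s U" and U: "nbhd_in \<tau> 0 U"
    and cpt: "compact (polar s \<tau> U)"
  shows "zero_in_core s U"
proof (rule ccontr)
  assume not_core: "\<not> zero_in_core s U"
  have vs: "vector_space s" using \<tau> by (simp add: elcs_def)
  interpret vector_space s by fact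
  let ?M = "{x. minkowski s U x < \<infinity>}"
  obtain x where x: "x \<notin> ?M"
    using not_core zero_in_core_iff_minkowski_finite[OF vs ac] by blast
  have "0 \<in> U" using U by (auto simp: nbhd_in_def)
  then have M: "subspace ?M"
    using extended_seminorm_minkowski[OF vs ac] subspace_finite_extended_seminorm[OF vs] by blast
  obtain f where f: "Vector_Spaces.linear s (*) f" "f x = 1" "\<And>y. y \<in> ?M \<Longrightarrow> f y = 0"
    using linear_functional_separating_subspace[OF vs M x] by blast
  have "U \<subseteq> ?M"
    unfolding minkowski_finite_iff by (auto intro!: exI[of _ 1])
  then have f0: "f y = 0" if "y \<in> U" for y using f(3) that by blast
  have "(\<lambda>y. of_nat n * f y) \<in> polar s \<tau> U" for n
    using f(1) f0 unfolding polar_eq_bounded_linear[OF \<tau> U]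
    by (auto simp: Vector_Spaces.linear_iff algebra_simps)
  then have "of_nat n \<in> (\<lambda>g. g x) ` polar s \<tau> U" for n
    using f(2) by (intro image_eqI[of _ _ "\<lambda>y. of_nat n * f y"]) auto
  moreover have "bounded ((\<lambda>g. g x) ` polar s \<tau> U)"
    using cpt by (intro compact_imp_bounded compact_continuous_image
      continuous_on_subset[OF continuous_on_product_coordinates subset_UNIV])
  ultimately obtain b where b: "\<And>n. norm (of_nat n :: 'a) \<le> b"
    unfolding bounded_iff by blast
  obtain n where "b < of_nat n" using reals_Archimedean2 by blast
  with b[of n] show False by simp
qed


section \<open>Neighbourhoods in the finest locally convex topology\<close>

text \<open>Finitely many finite seminorms have a common finite bound at each point \<open>x\<close>, so some positive
  multiple of \<open>x\<close> lies in a given basic neighbourhood of 0.\<close>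

lemma zero_in_core_if_lc_nbhd:
  assumes vs: "vector_space s" and lc: "locally_convex_topology s \<sigma>"
    and ac: "absolutely_convex s U" and U: "nbhd_in \<sigma> 0 U"
  shows "zero_in_core s U"
proof -
  obtain P where P: "\<forall>\<rho>\<in>P. extended_seminorm s \<rho>" "\<And>\<rho> x. \<rho> \<in> P \<Longrightarrow> \<rho> x < \<infinity>"
    "\<sigma> = seminorm_topology P"
    using lc unfolding locally_convex_topology_def by blast
  obtain J e where J: "J \<subseteq> P" "finite J" "0 < (e::real)" "{y. \<forall>\<rho>\<in>J. \<rho> y < ennreal e} \<subseteq> U"
    using U unfolding P(3) nbhd_in_seminorm_topology[OF vs P(1)] by auto
  have "\<exists>d>0. s (of_real d) x \<in> U" for x
  proof -
    define c where "c = (\<Sum>\<rho>\<in>J. enn2real (\<rho> x))"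
    have c: "0 \<le> c" "\<And>\<rho>. \<rho> \<in> J \<Longrightarrow> \<rho> x \<le> ennreal c"
    proof -
      show "0 \<le> c" by (simp add: c_def sum_nonneg)
      fix \<rho> assume \<rho>: "\<rho> \<in> J"
      then have "\<rho> x = ennreal (enn2real (\<rho> x))" using P(2) J(1) by (auto simp: less_top)
      also have "\<dots> \<le> ennreal c"
        unfolding c_def using \<rho> J(2) by (intro ennreal_leI member_le_sum) auto
      finally show "\<rho> x \<le> ennreal c" .
    qed
    \<comment> \<open>The 1 covers \<open>c = 0\<close> and makes \<open>d * c < e\<close> strict.\<close>
    define d where "d = e / (c + 1)"
    have d: "0 < d" using c J by (simp add: d_def)
    have "\<rho> (s (of_real d) x) < ennreal e" if "\<rho> \<in> J" for \<rho>
    proof -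
      have es: "extended_seminorm s \<rho>" using P(1) J(1) that by blast
      have "\<rho> (s (of_real d) x) = ennreal d * \<rho> x"
        using es d by (simp add: extended_seminorm_def)
      also have "\<dots> \<le> ennreal d * ennreal c"
        using c(2) that by (intro mult_left_mono) auto
      also have "\<dots> = ennreal (d * c)"
        using d c by (simp add: ennreal_mult)
      also have "\<dots> < ennreal e"
        using c J by (intro ennreal_lessI) (auto simp: d_def field_simps)
      finally show ?thesis .
    qed
    then show ?thesis using d J(4) by blast
  qed
  then show ?thesis
    unfolding zero_in_core_iff_minkowski_finite[OF vs ac] minkowski_finite_iff by blast
qed

text \<open>The Minkowski functional, now finite, induces a competitor in the definition of \<open>\<tau>F\<close>, and
  its open unit ball lies in \<open>U\<close>.\<close>

lemma flc_nbhd_if_zero_in_core: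
  assumes \<tau>: "elcs s \<tau>" and \<tau>F: "flc_topology s \<tau> \<tau>F"
    and ac: "absolutely_convex s U" and U: "nbhd_in \<tau> 0 U" and core: "zero_in_core s U"
  shows "nbhd_in \<tau>F 0 U"
proof -
  obtain P where vs: "vector_space s" and P: "\<forall>\<rho>\<in>P. extended_seminorm s \<rho>"
    and \<tau>_eq: "\<tau> = seminorm_topology P"
    using \<tau> unfolding elcs_def by blast
  interpret vector_space s by fact
  let ?p = "minkowski s U"
  have "0 \<in> U" using U by (auto simp: nbhd_in_def)
  then have p: "extended_seminorm s ?p" by (rule extended_seminorm_minkowski[OF vs ac])
  have "locally_convex_topology s (seminorm_topology {?p})"
    using p core zero_in_core_iff_minkowski_finite[OF vs ac]
    unfolding locally_convex_topology_def by blast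
  moreover have "coarser (seminorm_topology {?p}) \<tau>"
    using coarser_minkowski_topology[OF vs P] U unfolding \<tau>_eq by blast
  ultimately have "coarser (seminorm_topology {?p}) \<tau>F"
    using \<tau>F by (simp add: flc_topology_def)
  moreover have "nbhd_in (seminorm_topology {?p}) 0 U"
  proof -
    have "{y. \<forall>\<rho>\<in>{?p}. \<rho> (y - 0) < ennreal 1} \<subseteq> U"
      using minkowski_less_imp_mem[OF vs ac, of _ 1] by auto
    then show ?thesis
      using p by (subst nbhd_in_seminorm_topology[OF vs])
        (auto intro!: exI[of _ "{?p}"] exI[of _ 1])
  qed
  ultimately show ?thesis
    unfolding nbhd_in_def coarser_def by blast
qed

theorem theorem4p6:
  fixes s :: "'k::real_or_complex \<Rightarrow> 'x::ab_group_add \<Rightarrow> 'x"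
    and \<tau> \<tau>F :: "'x topology" and U :: "'x set"
  assumes "elcs s \<tau>"
    and "flc_topology s \<tau> \<tau>F"
    and "absolutely_convex s U"
    and "nbhd_in \<tau> 0 U"
  shows "(compactin (weak_star s \<tau>) (polar s \<tau> U) \<longleftrightarrow> zero_in_core s U) \<and>
         (zero_in_core s U \<longleftrightarrow> nbhd_in \<tau>F 0 U)"
proof -
  have "vector_space s" "locally_convex_topology s \<tau>F"
    using assms by (simp_all add: elcs_def flc_topology_def)
  then show ?thesis
    unfolding compactin_weak_star_polar_iff
    using assms zero_in_core_if_compact_polar compact_polar zero_in_core_if_lc_nbhd
      flc_nbhd_if_zero_in_core by blast
qed

end
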